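(* Let $N \ge 1$, let $m = [m_1,\dots,m_N]$ be any vector of positive integer delays and let $0 < \gamma < 1$. Put $\gamma_i = \gamma^{m_i}$ for $1 \le i \le N$ and $\Gamma = \operatorname{diag}(\gamma_1,\dots,\gamma_N)$. Let $p_1,\dots,p_N > 0$ be any real numbers with $$0 < \frac{p_{i-1}}{p_i} < \gamma_i^2 \quad \text{for } 2 \le i \le N$$ (such numbers exist), and put $q_i = \gamma_i^2 p_i$, $\mathcal{A}(x) = \prod_{k=1}^N (x - p_k)$, $\mathcal{B}(x) = \prod_{k=1}^N (x - q_k)$, and $$\alpha_i = -\frac{\mathcal{A}(q_i)}{\mathcal{B}'(q_i)}, \qquad \beta_i = \frac{\mathcal{B}(p_i)}{\mathcal{A}'(p_i)} \qquad (1 \le i \le N).$$ Then all $\alpha_i$ and $\beta_i$ are positive, the $N\times N$ matrix $U$ with entries $u_{ij} = \sqrt{\beta_i \alpha_j}/(p_i - q_j)$ is orthogonal, and there exist $b \in \mathbb{R}^{N\times 1}$, $c \in \mathbb{R}^{1\times N}$, $d \in \mathbb{R}$ such that the single-input single-output feedback delay network (FDN) with feedback matrix $A = U\Gamma$, input gains $b$, output gains $c$ and direct gain $d$ is uniallpass. In particular, for any delays $m$ and any decay rate $0<\gamma<1$ there exists a single-input single-output uniallpass FDN which, with delays $m$, has homogeneous decay with rate $\gamma$.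
   Context: A single-input single-output FDN with $N$ delay lines is given by $A \in \mathbb{R}^{N\times N}$, $b \in \mathbb{R}^{N\times 1}$, $c \in \mathbb{R}^{1\times N}$, $d \in \mathbb{R}$ and a vector of positive integer delays $m$; its transfer function is the rational function $H(z) = c\,(\operatorname{diag}(z^{m_1},\dots,z^{m_N}) - A)^{-1} b + d$. It is allpass if $H(z)H(z^{-1}) = 1$ as rational functions. The FDN $(A,b,c,d)$ is uniallpass if, with $A,b,c,d$ fixed, its transfer function is allpass for every vector of positive integer delays. The system poles for delays $m$ are the roots of the polynomial $\det(\operatorname{diag}(z^{m_1},\dots,z^{m_N}) - A)$ in $z$; the FDN with delays $m$ has homogeneous decay with rate $\gamma$ if all its system poles have modulus $\gamma$. *)

theory Defs
  imports
    "HOL-Computational_Algebra.Polynomial_Factorial"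
    "HOL-Computational_Algebra.Field_as_Ring"
    "Jordan_Normal_Form.Determinant"
    "Jordan_Normal_Form.Gauss_Jordan_Elimination"
begin

text \<open>
  The \<open>N\<close> delay lines are indexed by \<open>0, \<dots>, N - 1\<close>, as in the matrix library; sequences
  indexed by delay lines are functions on \<open>nat\<close>, only whose values below \<open>N\<close> matter.
  Rational functions are elements of \<open>real poly fract\<close>, the field \<open>\<real>(z)\<close>.
\<close>

subsection \<open>Rational functions\<close>

definition rf_const :: "real \<Rightarrow> real poly fract" where
  "rf_const a = to_fract [:a:]"

definition rf_z :: "real poly fract" where
  "rf_z = to_fract [:0, 1:]"

text \<open>Substitution of \<open>g\<close> for the indeterminate in \<open>f\<close>, meaningful for non-constant \<open>g\<close>;
  \<open>quot_of_fract f\<close> is the reduced fraction representing \<open>f\<close>.\<close>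

definition rf_subst :: "real poly fract \<Rightarrow> real poly fract \<Rightarrow> real poly fract" where
  "rf_subst f g =
     (case quot_of_fract f of (r, s) \<Rightarrow> poly (map_poly rf_const r) g / poly (map_poly rf_const s) g)"

definition rf_allpass :: "real poly fract \<Rightarrow> bool" where
  "rf_allpass H \<longleftrightarrow> H * rf_subst H (inverse rf_z) = 1"

subsection \<open>Feedback delay networks\<close>

definition loop_mat :: "nat \<Rightarrow> (nat \<Rightarrow> nat) \<Rightarrow> real mat \<Rightarrow> real poly mat" where
  "loop_mat N m A = mat_diag N (\<lambda>i. monom 1 (m i)) - map_mat (\<lambda>a. [:a:]) A"

text \<open>For \<open>A\<close> of size \<open>N \<times> N\<close> and positive delays, \<open>det (loop_mat N m A)\<close> is monic, so
  \<open>mat_inverse\<close> below does not return \<open>None\<close>.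
  The only entry of the \<open>1 \<times> 1\<close> matrix is extracted.\<close>

definition transfer_function ::
  "nat \<Rightarrow> (nat \<Rightarrow> nat) \<Rightarrow> real mat \<Rightarrow> real mat \<Rightarrow> real mat \<Rightarrow> real \<Rightarrow> real poly fract" where
  "transfer_function N m A b c d =
     (map_mat rf_const c * the (mat_inverse (map_mat to_fract (loop_mat N m A))) * map_mat rf_const b)
       $$ (0, 0) + rf_const d"

definition uniallpass :: "nat \<Rightarrow> real mat \<Rightarrow> real mat \<Rightarrow> real mat \<Rightarrow> real \<Rightarrow> bool" where
  "uniallpass N A b c d \<longleftrightarrow>
     (\<forall>m. (\<forall>i<N. 0 < m i) \<longrightarrow> rf_allpass (transfer_function N m A b c d))"

definition system_poles :: "nat \<Rightarrow> (nat \<Rightarrow> nat) \<Rightarrow> real mat \<Rightarrow> complex set" where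
  "system_poles N m A = {z. poly (map_poly complex_of_real (det (loop_mat N m A))) z = 0}"

definition homogeneous_decay :: "nat \<Rightarrow> (nat \<Rightarrow> nat) \<Rightarrow> real mat \<Rightarrow> real \<Rightarrow> bool" where
  "homogeneous_decay N m A \<gamma> \<longleftrightarrow> (\<forall>z \<in> system_poles N m A. cmod z = \<gamma>)"

subsection \<open>Orthogonal matrices and the Cauchy-like construction\<close>

text \<open>The library's \<^const>\<open>orthogonal_mat\<close> only requires the columns to be nonzero and pairwise
  orthogonal, not normalized.\<close>

definition orthonormal_mat :: "nat \<Rightarrow> real mat \<Rightarrow> bool" where
  "orthonormal_mat N U \<longleftrightarrow>
     U \<in> carrier_mat N N \<and> transpose_mat U * U = 1\<^sub>m N \<and> U * transpose_mat U = 1\<^sub>m N"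

definition gain :: "real \<Rightarrow> (nat \<Rightarrow> nat) \<Rightarrow> nat \<Rightarrow> real" where
  "gain \<gamma> m i = \<gamma> ^ m i"

definition admissible_nodes :: "nat \<Rightarrow> (nat \<Rightarrow> real) \<Rightarrow> (nat \<Rightarrow> real) \<Rightarrow> bool" where
  "admissible_nodes N g p \<longleftrightarrow>
     (\<forall>i<N. 0 < p i) \<and>
     (\<forall>i. 1 \<le> i \<and> i < N \<longrightarrow> 0 < p (i - 1) / p i \<and> p (i - 1) / p i < (g i)\<^sup>2)"

definition node_poly :: "nat \<Rightarrow> (nat \<Rightarrow> real) \<Rightarrow> real poly" where
  "node_poly N x = (\<Prod>k<N. [:- x k, 1:])"

definition alpha :: "nat \<Rightarrow> (nat \<Rightarrow> real) \<Rightarrow> (nat \<Rightarrow> real) \<Rightarrow> nat \<Rightarrow> real" where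
  "alpha N p q i = - (poly (node_poly N p) (q i) / poly (pderiv (node_poly N q)) (q i))"

definition beta :: "nat \<Rightarrow> (nat \<Rightarrow> real) \<Rightarrow> (nat \<Rightarrow> real) \<Rightarrow> nat \<Rightarrow> real" where
  "beta N p q i = poly (node_poly N q) (p i) / poly (pderiv (node_poly N p)) (p i)"

definition cauchy_like_mat :: "nat \<Rightarrow> (nat \<Rightarrow> real) \<Rightarrow> (nat \<Rightarrow> real) \<Rightarrow> real mat" where
  "cauchy_like_mat N p q =
     mat N N (\<lambda>(i, j). sqrt (beta N p q i * alpha N p q j) / (p i - q j))"

end

theory Submission
  imports Defs "Jordan_Normal_Form.Char_Poly"
begin

text \<open>
  Partial fractions of \<open>\<A>/\<B>\<close> and \<open>\<B>/\<A>\<close> give the orthogonality of \<open>U\<close> and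
  \<open>U\<^sup>T P\<inverse> U = Q\<inverse> - \<delta>\<^sup>2 Q\<inverse> a a\<^sup>T Q\<inverse>\<close>, where \<open>P = diag p\<close>, \<open>Q = diag q\<close>,
  \<open>a = (\<surd>\<alpha>\<^sub>j)\<^sub>j\<close> and \<open>\<delta>\<^sup>2 = \<B>(0)/\<A>(0) = \<Prod> q\<^sub>i/p\<^sub>i\<close>.
  With \<open>A = U\<Gamma>\<close>, \<open>b = (\<surd>\<beta>\<^sub>i)\<^sub>i\<close>, \<open>c = - \<delta> a\<^sup>T \<Gamma> Q\<inverse>\<close>, \<open>d = \<delta>\<close>, the system matrix
  \<open>V = [A b; c d]\<close> then satisfies \<open>V\<^sup>T X V = X\<close> for the diagonal matrix \<open>X = diag (P\<inverse>, 1)\<close>.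
  If \<open>D(z) = diag z\<^sup>m\<close> and \<open>v = (D(z) - A)\<inverse> b\<close>, then \<open>V (v, 1) = (D(z) v, H(z))\<close>; pairing this
  under \<open>X\<close> with the same identity at \<open>z\<inverse>\<close>, the diagonal matrices \<open>D(z)\<close> and \<open>D(z\<inverse>)\<close> cancel,
  whatever the delays, and \<open>H(z) H(z\<inverse>) = 1\<close> remains.
  At a system pole, \<open>D(z) v = U\<Gamma>v\<close> for some \<open>v \<noteq> 0\<close>, so
  \<open>\<parallel>D(z) v\<parallel> = \<parallel>\<Gamma>v\<parallel>\<close>; this forces \<open>\<bar>z\<bar> = \<gamma>\<close>.
\<close>

subsection \<open>Partial fractions\<close>

lemma poly_node_poly: "poly (node_poly N x) t = (\<Prod>k<N. t - x k)"
  by (simp add: node_poly_def poly_prod)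

text \<open>The quotient of \<open>node_poly N x\<close> by its i-th linear factor, kept as a
  polynomial so that it can be evaluated and differentiated at the nodes; at \<open>x i\<close> it
  takes the value of the derivative of \<open>node_poly N x\<close>.\<close>

definition node_cofactor :: "nat \<Rightarrow> (nat \<Rightarrow> real) \<Rightarrow> nat \<Rightarrow> real poly" where
  "node_cofactor N x i = (\<Prod>k\<in>{..<N} - {i}. [:- x k, 1:])"

lemma poly_node_cofactor: "poly (node_cofactor N x i) t = (\<Prod>k\<in>{..<N} - {i}. t - x k)"
  by (simp add: node_cofactor_def poly_prod)

lemma node_poly_conv_cofactor:
  "i < N \<Longrightarrow> node_poly N x = [:- x i, 1:] * node_cofactor N x i"
  unfolding node_poly_def node_cofactor_def by (subst prod.remove[of _ i]) auto

lemma poly_node_poly_conv_cofactor: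
  "i < N \<Longrightarrow> poly (node_poly N x) t = (t - x i) * poly (node_cofactor N x i) t"
  by (simp add: node_poly_conv_cofactor algebra_simps)

lemma poly_pderiv_node_poly:
  "i < N \<Longrightarrow> poly (pderiv (node_poly N x)) t =
     poly (node_cofactor N x i) t + (t - x i) * poly (pderiv (node_cofactor N x i)) t"
  by (simp add: node_poly_conv_cofactor pderiv_mult pderiv_pCons del: mult_pCons_left)

lemma poly_pderiv_node_poly_node:
  "i < N \<Longrightarrow> poly (pderiv (node_poly N x)) (x i) = (\<Prod>k\<in>{..<N} - {i}. x i - x k)"
  by (simp add: poly_pderiv_node_poly poly_node_cofactor)

lemma degree_node_poly: "degree (node_poly N x) = N"
  unfolding node_poly_def by (subst degree_prod_eq_sum_degree) auto

lemma degree_node_cofactor: "i < N \<Longrightarrow> degree (node_cofactor N x i) < N"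
  unfolding node_cofactor_def by (subst degree_prod_eq_sum_degree) auto

lemma lead_coeff_node_poly: "coeff (node_poly N x) N = 1"
proof -
  have "lead_coeff (node_poly N x) = 1"
    unfolding node_poly_def by (simp add: lead_coeff_prod)
  then show ?thesis by (simp add: degree_node_poly)
qed

text \<open>The expansion A/B = 1 - sum of alpha_j / (t - y_j), cleared of denominators. Both sides
  have degree at most N and the same coefficient 1 at N, and they agree at the N distinct nodes
  \<open>y i\<close>, where only the i-th cofactor survives.\<close>

lemma node_poly_partial_fractions:
  assumes inj: "inj_on y {..<N}"
  shows "node_poly N x =
    node_poly N y - (\<Sum>j<N. smult (alpha N x y j) (node_cofactor N y j))"
proof (rule poly_eqI_degree_lead_coeff[where n = N and A = "y ` {..<N}"])
  have deg: "degree (smult (alpha N x y j) (node_cofactor N y j)) < N" if "j < N" for j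
    using degree_node_cofactor[OF that, of y] by simp
  show "coeff (node_poly N x) N =
    coeff (node_poly N y - (\<Sum>j<N. smult (alpha N x y j) (node_cofactor N y j))) N"
    using deg by (simp add: lead_coeff_node_poly coeff_sum coeff_eq_0 degree_node_cofactor)
  show "N \<le> card (y ` {..<N})"
    by (simp add: card_image inj)
  show "degree (node_poly N x) \<le> N"
    by (simp add: degree_node_poly)
  show "degree (node_poly N y - (\<Sum>j<N. smult (alpha N x y j) (node_cofactor N y j))) \<le> N"
    using deg by (intro degree_diff_le degree_sum_le) (simp_all add: degree_node_poly less_imp_le)
  fix t assume "t \<in> y ` {..<N}"
  then obtain i where i: "i < N" "t = y i" by auto
  have nz: "(\<Prod>k\<in>{..<N} - {i}. y i - y k) \<noteq> 0"
    using inj i by (auto simp: inj_on_def)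
  have "poly (node_cofactor N y j) (y i) = 0" if "j < N" "j \<noteq> i" for j
    using that i by (auto simp: poly_node_cofactor)
  then have "(\<Sum>j<N. alpha N x y j * poly (node_cofactor N y j) (y i)) =
      alpha N x y i * poly (node_cofactor N y i) (y i)"
    using i by (subst sum.remove[of _ i]) auto
  also have "\<dots> = - poly (node_poly N x) (y i)"
    using nz i by (simp add: alpha_def poly_pderiv_node_poly_node poly_node_cofactor)
  finally show "poly (node_poly N x) t =
    poly (node_poly N y - (\<Sum>j<N. smult (alpha N x y j) (node_cofactor N y j))) t"
    using i by (auto simp: poly_sum poly_node_poly[of _ y])
qed

lemma sum_alpha_over_diff:
  assumes inj: "inj_on y {..<N}" and t: "\<And>j. j < N \<Longrightarrow> t \<noteq> y j"
  shows "(\<Sum>j<N. alpha N x y j / (t - y j)) = 1 - poly (node_poly N x) t / poly (node_poly N y) t"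
proof -
  let ?B = "poly (node_poly N y) t"
  have B: "?B \<noteq> 0" using t by (auto simp: poly_node_poly)
  have "poly (node_cofactor N y j) t = ?B / (t - y j)" if "j < N" for j
    using t[OF that] by (simp add: poly_node_poly_conv_cofactor[OF that])
  then have "(\<Sum>j<N. alpha N x y j * poly (node_cofactor N y j) t) =
      ?B * (\<Sum>j<N. alpha N x y j / (t - y j))"
    by (simp add: sum_distrib_left mult.commute)
  moreover have "poly (node_poly N x) t =
      ?B - (\<Sum>j<N. alpha N x y j * poly (node_cofactor N y j) t)"
    by (subst node_poly_partial_fractions[OF inj]) (simp add: poly_sum)
  ultimately show ?thesis using B by (simp add: field_simps)
qed

lemma sum_alpha_over_node_diff:
  assumes "inj_on y {..<N}" and "\<And>j. j < N \<Longrightarrow> x i \<noteq> y j" and "i < N"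
  shows "(\<Sum>j<N. alpha N x y j / (x i - y j)) = 1"
proof -
  have "poly (node_poly N x) (x i) = 0" using assms(3) by (auto simp: poly_node_poly)
  then show ?thesis using sum_alpha_over_diff[OF assms(1,2)] by simp
qed

text \<open>Differentiate the partial fraction identity at the zero \<open>x i\<close> of A. The
  cofactors contribute B' times a sum equal to 1, which cancels B', and -B times the sum of squares,
  so A' = B * S remains.\<close>

lemma sum_alpha_over_node_diff_square:
  assumes inj: "inj_on y {..<N}" and ne: "\<And>j. j < N \<Longrightarrow> x i \<noteq> y j" and i: "i < N"
  shows "(\<Sum>j<N. alpha N x y j / (x i - y j)\<^sup>2) =
    poly (pderiv (node_poly N x)) (x i) / poly (node_poly N y) (x i)"
proof -
  let ?t = "x i" and ?S = "\<Sum>j<N. alpha N x y j / (x i - y j)\<^sup>2"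
  let ?B = "poly (node_poly N y) ?t" and ?B' = "poly (pderiv (node_poly N y)) ?t"
  have B: "?B \<noteq> 0" using ne by (auto simp: poly_node_poly)
  have "poly (pderiv (node_cofactor N y j)) ?t = ?B' / (?t - y j) - ?B / (?t - y j)\<^sup>2"
    if "j < N" for j
  proof -
    have "?B = (?t - y j) * poly (node_cofactor N y j) ?t"
      and "?B' = poly (node_cofactor N y j) ?t + (?t - y j) * poly (pderiv (node_cofactor N y j)) ?t"
      using that by (rule poly_node_poly_conv_cofactor, rule poly_pderiv_node_poly)
    then show ?thesis
      using ne[OF that] by (simp add: add_divide_distrib power2_eq_square)
  qed
  then have "(\<Sum>j<N. alpha N x y j * poly (pderiv (node_cofactor N y j)) ?t) =
      (\<Sum>j<N. ?B' * (alpha N x y j / (?t - y j)) - ?B * (alpha N x y j / (?t - y j)\<^sup>2))"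
    by (intro sum.cong) (simp_all add: right_diff_distrib mult.commute)
  also have "\<dots> = ?B' - ?B * ?S"
    by (simp only: sum_subtractf sum_distrib_left[symmetric]
        sum_alpha_over_node_diff[of y N x i, OF inj ne i] mult_1_right)
  finally have "poly (pderiv (node_poly N x)) ?t = ?B * ?S"
    by (subst node_poly_partial_fractions[OF inj])
      (simp add: pderiv_diff poly_sum pderiv_smult pderiv_sum)
  then show ?thesis using B by simp
qed

text \<open>Exchanging p and q turns each identity for \<open>alpha\<close> into one for
  \<open>beta\<close>.\<close>

lemma beta_conv_alpha: "beta N p q i = - alpha N q p i"
  by (simp add: alpha_def beta_def)

subsection \<open>The substitution of \<open>1 / z\<close> as a field homomorphism\<close>

interpretation to_fract_hom: inj_idom_hom "to_fract :: real poly \<Rightarrow> real poly fract"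
  by unfold_locales auto

interpretation rf_const: inj_idom_hom rf_const
  by unfold_locales (auto simp: rf_const_def one_pCons simp flip: to_fract_hom.hom_add to_fract_hom.hom_mult)

interpretation rf_const_poly: map_poly_inj_idom_hom rf_const ..

lemma poly_map_poly_rf_z: "poly (map_poly rf_const p) rf_z = to_fract p"
proof (induction p)
  case (pCons a p)
  have "pCons a p = [:a:] + [:0, 1:] * p" by simp
  then have "to_fract (pCons a p) = rf_const a + rf_z * to_fract p"
    by (simp only: rf_const_def rf_z_def to_fract_hom.hom_add to_fract_hom.hom_mult)
  with pCons show ?case by (simp add: rf_const.map_poly_pCons_hom)
qed simp

lemma rf_z_nonzero [simp]: "rf_z \<noteq> 0"
  by (simp add: rf_z_def)

definition rf_reciprocal_poly :: "real poly \<Rightarrow> real poly fract" where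
  "rf_reciprocal_poly p = poly (map_poly rf_const p) (inverse rf_z)"

interpretation rf_reciprocal_poly: idom_hom rf_reciprocal_poly
  by unfold_locales (simp_all add: rf_reciprocal_poly_def hom_distribs)

text \<open>Multiplying p(1/z) by a power of z gives the reflected polynomial evaluated at z, and
  reflection sends only 0 to 0. Hence denominators stay nonzero under the substitution.\<close>

lemma rf_reciprocal_poly_eq_0_iff [simp]: "rf_reciprocal_poly p = 0 \<longleftrightarrow> p = 0"
proof
  assume "rf_reciprocal_poly p = 0"
  then have "poly (reflect_poly (map_poly rf_const p)) rf_z = 0"
    by (simp add: poly_reflect_poly_nz rf_reciprocal_poly_def)
  moreover have "reflect_poly (map_poly rf_const p) = map_poly rf_const (reflect_poly p)"
    by (rule poly_eqI) (simp add: coeff_reflect_poly)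
  ultimately show "p = 0"
    by (simp add: poly_map_poly_rf_z)
qed simp

text \<open>\<open>rf_subst\<close> is defined through the reduced fraction. Cross-multiplication
  shows that any other representation gives the same value.\<close>

lemma rf_subst_reciprocal_divide:
  assumes "q \<noteq> 0"
  shows "rf_subst (to_fract p / to_fract q) (inverse rf_z) =
    rf_reciprocal_poly p / rf_reciprocal_poly q"
proof -
  obtain r s where rs: "quot_of_fract (to_fract p / to_fract q) = (r, s)" by force
  have s: "s \<noteq> 0" using snd_quot_of_fract_nonzero[of "to_fract p / to_fract q"] rs by simp
  have "to_fract p / to_fract q = Fract r s"
    using Fract_quot_of_fract[of "to_fract p / to_fract q"] rs by simp
  also have "\<dots> = to_fract r / to_fract s" by (rule Fract_conv_to_fract)
  finally have "to_fract (p * s) = to_fract (q * r)"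
    using assms s by (simp add: field_simps)
  then have "p * s = q * r" by (simp only: to_fract_eq_iff)
  then have "rf_reciprocal_poly p * rf_reciprocal_poly s = rf_reciprocal_poly q * rf_reciprocal_poly r"
    by (simp flip: rf_reciprocal_poly.hom_mult)
  moreover have "rf_subst (to_fract p / to_fract q) (inverse rf_z) =
      rf_reciprocal_poly r / rf_reciprocal_poly s"
    by (simp add: rf_subst_def rs rf_reciprocal_poly_def)
  ultimately show ?thesis
    using assms s by (simp add: frac_eq_eq mult.commute)
qed

lemma rf_cases:
  fixes f :: "real poly fract"
  obtains p q where "q \<noteq> 0" "f = to_fract p / to_fract q"
  using Fract_quot_of_fract[of f] snd_quot_of_fract_nonzero[of f] Fract_conv_to_fract by metis

definition rf_reciprocal :: "real poly fract \<Rightarrow> real poly fract" where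
  "rf_reciprocal f = rf_subst f (inverse rf_z)"

lemma rf_reciprocal_divide:
  "q \<noteq> 0 \<Longrightarrow> rf_reciprocal (to_fract p / to_fract q) = rf_reciprocal_poly p / rf_reciprocal_poly q"
  by (simp add: rf_reciprocal_def rf_subst_reciprocal_divide)

lemma rf_reciprocal_to_fract: "rf_reciprocal (to_fract p) = rf_reciprocal_poly p"
  using rf_reciprocal_divide[of 1 p] by simp

text \<open>Compatibility with sums and products carries linear equations over the rational
  functions from z to 1/z.\<close>

interpretation rf_reciprocal: idom_hom rf_reciprocal
proof
  fix f g :: "real poly fract"
  obtain p q where f: "q \<noteq> 0" "f = to_fract p / to_fract q"
    using rf_cases by blast
  obtain r s where g: "s \<noteq> 0" "g = to_fract r / to_fract s"
    using rf_cases by blast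
  have "f + g = to_fract (p * s + q * r) / to_fract (q * s)"
    using f g by (simp add: field_simps)
  then show "rf_reciprocal (f + g) = rf_reciprocal f + rf_reciprocal g"
    using f g by (simp only: rf_reciprocal_divide mult_eq_0_iff simp_thms)
      (simp add: field_simps rf_reciprocal_poly.hom_add rf_reciprocal_poly.hom_mult)
  have "f * g = to_fract (p * r) / to_fract (q * s)"
    using f g by simp
  then show "rf_reciprocal (f * g) = rf_reciprocal f * rf_reciprocal g"
    using f g by (simp only: rf_reciprocal_divide mult_eq_0_iff simp_thms)
      (simp add: rf_reciprocal_poly.hom_mult)
next
  show "rf_reciprocal 0 = 0" "rf_reciprocal 1 = 1"
    using rf_reciprocal_to_fract[of 0] rf_reciprocal_to_fract[of 1] by simp_all
qed

lemma rf_reciprocal_const [simp]: "rf_reciprocal (rf_const a) = rf_const a"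
  using rf_reciprocal_to_fract[of "[:a:]"]
  by (simp add: rf_reciprocal_poly_def rf_const.map_poly_pCons_hom flip: rf_const_def)

lemma rf_reciprocal_z: "rf_reciprocal rf_z = inverse rf_z"
  using rf_reciprocal_to_fract[of "[:0, 1:]"]
  by (simp add: rf_reciprocal_poly_def rf_const.map_poly_pCons_hom flip: rf_z_def)

lemma to_fract_monom: "to_fract (monom 1 n) = rf_z ^ n"
  unfolding rf_z_def x_as_monom to_fract_hom.hom_power[symmetric] x_pow_n ..

subsection \<open>Lossless systems are uniallpass\<close>

text \<open>The hypotheses are the blocks of V^T X V = X for V = [a b; c d] and X = diag(w, 1); the
  conclusion is the bilinear form of X evaluated at V(v, 1) and V(v', 1). A general commutative ring
  covers both rational functions and complex numbers.\<close>

lemma lossless_quadratic_form: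
  fixes w b c v v' :: "nat \<Rightarrow> 'a :: comm_ring_1" and a :: "nat \<Rightarrow> nat \<Rightarrow> 'a" and d :: 'a
  assumes aa: "\<And>j k. j < N \<Longrightarrow> k < N \<Longrightarrow>
      (\<Sum>i<N. w i * a i j * a i k) + c j * c k = (if j = k then w j else 0)"
    and ab: "\<And>j. j < N \<Longrightarrow> (\<Sum>i<N. w i * a i j * b i) + c j * d = 0"
    and bb: "(\<Sum>i<N. w i * b i * b i) + d * d = 1"
  defines "s \<equiv> \<lambda>v i. (\<Sum>j<N. a i j * v j) + b i"
    and "h \<equiv> \<lambda>v. (\<Sum>j<N. c j * v j) + d"
  shows "(\<Sum>i<N. w i * s v i * s v' i) + h v * h v' = (\<Sum>j<N. w j * v j * v' j) + 1"
proof -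
  \<comment> \<open>Both factors are affine in the state. Expand into a bilinear, two linear and one
    constant part, with the sum over i innermost, where the hypotheses apply.\<close>
  have 1: "(\<Sum>i<N. w i * s v i * s v' i) =
      (\<Sum>j<N. \<Sum>k<N. v j * v' k * (\<Sum>i<N. w i * a i j * a i k)) +
      (\<Sum>j<N. v j * (\<Sum>i<N. w i * a i j * b i)) +
      (\<Sum>k<N. v' k * (\<Sum>i<N. w i * a i k * b i)) + (\<Sum>i<N. w i * b i * b i)"
  proof -
    have "(\<Sum>i<N. w i * s v i * s v' i) =
      (\<Sum>i<N. (\<Sum>j<N. \<Sum>k<N. v j * v' k * (w i * a i j * a i k)) +
        (\<Sum>j<N. v j * (w i * a i j * b i)) +
        (\<Sum>k<N. v' k * (w i * a i k * b i)) + w i * b i * b i)"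
    proof (rule sum.cong[OF refl])
      fix i
      have e1: "(\<Sum>j<N. \<Sum>k<N. v j * v' k * (w i * a i j * a i k)) =
          w i * ((\<Sum>j<N. a i j * v j) * (\<Sum>k<N. a i k * v' k))"
        by (simp only: sum_product) (simp only: sum_distrib_left mult_ac)
      have e2: "(\<Sum>j<N. x j * (w i * a i j * b i)) = w i * b i * (\<Sum>j<N. a i j * x j)" for x
        unfolding sum_distrib_left by (intro sum.cong refl) (simp add: mult_ac)
      show "w i * s v i * s v' i = (\<Sum>j<N. \<Sum>k<N. v j * v' k * (w i * a i j * a i k)) +
        (\<Sum>j<N. v j * (w i * a i j * b i)) +
        (\<Sum>k<N. v' k * (w i * a i k * b i)) + w i * b i * b i"
        unfolding e1 e2 s_def by (simp add: algebra_simps)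
    qed
    moreover have "(\<Sum>i<N. \<Sum>j<N. \<Sum>k<N. v j * v' k * (w i * a i j * a i k)) =
        (\<Sum>j<N. \<Sum>k<N. v j * v' k * (\<Sum>i<N. w i * a i j * a i k))"
      unfolding sum_distrib_left by (subst sum.swap, rule sum.cong[OF refl], rule sum.swap)
    moreover have "(\<Sum>i<N. \<Sum>j<N. x j * (w i * a i j * b i)) =
        (\<Sum>j<N. x j * (\<Sum>i<N. w i * a i j * b i))" for x
      unfolding sum_distrib_left by (rule sum.swap)
    ultimately show ?thesis
      by (simp only: sum.distrib)
  qed
  have 2: "h v * h v' = (\<Sum>j<N. \<Sum>k<N. v j * v' k * (c j * c k)) +
      (\<Sum>j<N. v j * (c j * d)) + (\<Sum>k<N. v' k * (c k * d)) + d * d"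
  proof -
    have e1: "(\<Sum>j<N. \<Sum>k<N. v j * v' k * (c j * c k)) =
        (\<Sum>j<N. c j * v j) * (\<Sum>k<N. c k * v' k)"
      unfolding sum_product by (intro sum.cong refl) (simp add: mult_ac)
    have e2: "(\<Sum>j<N. x j * (c j * d)) = d * (\<Sum>j<N. c j * x j)" for x
      unfolding sum_distrib_left by (intro sum.cong refl) (simp add: mult_ac)
    show ?thesis unfolding e1 e2 h_def by (simp add: algebra_simps)
  qed
  have "(\<Sum>i<N. w i * s v i * s v' i) + h v * h v' =
      (\<Sum>j<N. \<Sum>k<N. v j * v' k * ((\<Sum>i<N. w i * a i j * a i k) + c j * c k)) +
      (\<Sum>j<N. v j * ((\<Sum>i<N. w i * a i j * b i) + c j * d)) +
      (\<Sum>k<N. v' k * ((\<Sum>i<N. w i * a i k * b i) + c k * d)) +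
      ((\<Sum>i<N. w i * b i * b i) + d * d)"
    unfolding 1 2 by (simp only: sum.distrib distrib_left ac_simps)
  also have "\<dots> = (\<Sum>j<N. \<Sum>k<N. v j * v' k * (if j = k then w j else 0)) + 1"
    by (simp add: aa ab bb)
  also have "(\<Sum>j<N. \<Sum>k<N. v j * v' k * (if j = k then w j else 0)) = (\<Sum>j<N. w j * v j * v' j)"
    by (intro sum.cong refl) (simp add: sum.delta if_distrib mult_ac cong: if_cong)
  finally show ?thesis .
qed

text \<open>The state v = (D(z) - A)^{-1} b replaces the matrix inverse by linear equations, on
  which the substitution of 1/z can act entrywise.\<close>

lemma transfer_function_state:
  assumes A: "A \<in> carrier_mat N N" and b: "b \<in> carrier_mat N 1" and c: "c \<in> carrier_mat 1 N"
    and det: "det (loop_mat N m A) \<noteq> 0"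
  obtains v where
    "\<And>i. i < N \<Longrightarrow> rf_z ^ m i * v i =
      (\<Sum>j<N. rf_const (A $$ (i, j)) * v j) + rf_const (b $$ (i, 0))"
    "transfer_function N m A b c d = (\<Sum>j<N. rf_const (c $$ (0, j)) * v j) + rf_const d"
proof -
  let ?M = "map_mat to_fract (loop_mat N m A)"
  have M: "?M \<in> carrier_mat N N" using A by (auto simp: loop_mat_def intro!: minus_carrier_mat)
  have "det ?M \<noteq> 0" using det by simp
  \<comment> \<open>\<open>mat_inverse\<close> gives \<open>None\<close> only on non-units, so
    \<open>the\<close> in \<open>transfer_function\<close> returns a genuine inverse.\<close>
  then have "?M \<in> Units (ring_mat TYPE(real poly fract) N ())"
    by (rule det_non_zero_imp_unit[OF M])
  then obtain B where B: "mat_inverse ?M = Some B"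
    using mat_inverse(1)[OF M, of "()"] by (cases "mat_inverse ?M") auto
  then have MB: "?M * B = 1\<^sub>m N" and Bc: "B \<in> carrier_mat N N"
    using mat_inverse(2)[OF M] by auto
  define V where "V = B * map_mat rf_const b"
  define v where "v j = V $$ (j, 0)" for j
  have V: "V \<in> carrier_mat N 1" using Bc b by (simp add: V_def)
  have MV: "?M * V = map_mat rf_const b"
    unfolding V_def using assoc_mult_mat[OF M Bc, of "map_mat rf_const b" 1] b MB by simp
  have Mij: "?M $$ (i, j) = (if i = j then rf_z ^ m i else 0) - rf_const (A $$ (i, j))"
    if "i < N" "j < N" for i j
    using that A by (auto simp: loop_mat_def mat_diag_def to_fract_monom rf_const_def)
  show thesis
  proof
    fix i assume i: "i < N"
    have "rf_const (b $$ (i, 0)) = (?M * V) $$ (i, 0)"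
      using i b by (simp add: MV)
    also have "\<dots> = (\<Sum>j<N. ?M $$ (i, j) * v j)"
      using i M V by (simp add: scalar_prod_def atLeast0LessThan v_def del: index_map_mat)
    also have "\<dots> = (\<Sum>j<N. (if i = j then rf_z ^ m i * v j else 0) - rf_const (A $$ (i, j)) * v j)"
      using i by (intro sum.cong refl) (auto simp: Mij left_diff_distrib simp del: index_map_mat)
    also have "\<dots> = rf_z ^ m i * v i - (\<Sum>j<N. rf_const (A $$ (i, j)) * v j)"
      using i by (simp add: sum_subtractf)
    finally show "rf_z ^ m i * v i =
      (\<Sum>j<N. rf_const (A $$ (i, j)) * v j) + rf_const (b $$ (i, 0))"
      by (simp add: algebra_simps)
  next
    have "map_mat rf_const c * B * map_mat rf_const b = map_mat rf_const c * V"
      unfolding V_def using assoc_mult_mat[of "map_mat rf_const c" 1 N B N "map_mat rf_const b" 1] b c Bc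
      by simp
    then show "transfer_function N m A b c d = (\<Sum>j<N. rf_const (c $$ (0, j)) * v j) + rf_const d"
      using c V by (simp add: transfer_function_def B scalar_prod_def atLeast0LessThan v_def)
  qed
qed

text \<open>The losslessness conditions involve only the constants A, b, c, d and w, so a single
  weight w serves all delay vectors at once.\<close>

lemma uniallpass_if_lossless:
  assumes A: "A \<in> carrier_mat N N" and b: "b \<in> carrier_mat N 1" and c: "c \<in> carrier_mat 1 N"
    and det: "\<And>m. \<forall>i<N. 0 < m i \<Longrightarrow> det (loop_mat N m A) \<noteq> 0"
    and AA: "\<And>j k. j < N \<Longrightarrow> k < N \<Longrightarrow>
      (\<Sum>i<N. w i * A $$ (i, j) * A $$ (i, k)) + c $$ (0, j) * c $$ (0, k) =
        (if j = k then w j else 0)"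
    and Ab: "\<And>j. j < N \<Longrightarrow> (\<Sum>i<N. w i * A $$ (i, j) * b $$ (i, 0)) + c $$ (0, j) * d = 0"
    and bb: "(\<Sum>i<N. w i * b $$ (i, 0) * b $$ (i, 0)) + d * d = 1"
  shows "uniallpass N A b c d"
  unfolding uniallpass_def rf_allpass_def
proof (intro allI impI)
  fix m :: "nat \<Rightarrow> nat" assume m: "\<forall>i<N. 0 < m i"
  let ?H = "transfer_function N m A b c d"
  let ?C = rf_const
  obtain v where v: "\<And>i. i < N \<Longrightarrow> rf_z ^ m i * v i =
      (\<Sum>j<N. ?C (A $$ (i, j)) * v j) + ?C (b $$ (i, 0))"
    and H: "?H = (\<Sum>j<N. ?C (c $$ (0, j)) * v j) + ?C d"
    by (rule transfer_function_state[OF A b c det[OF m], where d = d]) (rule that)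
  \<comment> \<open>The entries of A, b and c are constants fixed by the substitution, so v' solves
    the state equations at 1/z.\<close>
  define v' where "v' j = rf_reciprocal (v j)" for j
  have v': "inverse rf_z ^ m i * v' i = (\<Sum>j<N. ?C (A $$ (i, j)) * v' j) + ?C (b $$ (i, 0))"
    if "i < N" for i
    using arg_cong[OF v[OF that], of rf_reciprocal]
    by (simp add: hom_distribs rf_reciprocal_z v'_def)
  have H': "rf_reciprocal ?H = (\<Sum>j<N. ?C (c $$ (0, j)) * v' j) + ?C d"
    by (simp add: H hom_distribs v'_def)
  have AA': "(\<Sum>i<N. ?C (w i) * ?C (A $$ (i, j)) * ?C (A $$ (i, k))) +
      ?C (c $$ (0, j)) * ?C (c $$ (0, k)) = (if j = k then ?C (w j) else 0)"
    if "j < N" "k < N" for j k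
    using arg_cong[OF AA[OF that], of ?C] by (simp add: hom_distribs split: if_splits)
  have Ab': "(\<Sum>i<N. ?C (w i) * ?C (A $$ (i, j)) * ?C (b $$ (i, 0))) + ?C (c $$ (0, j)) * ?C d = 0"
    if "j < N" for j
    using arg_cong[OF Ab[OF that], of ?C] by (simp add: hom_distribs)
  have bb': "(\<Sum>i<N. ?C (w i) * ?C (b $$ (i, 0)) * ?C (b $$ (i, 0))) + ?C d * ?C d = 1"
    using arg_cong[OF bb, of ?C] by (simp add: hom_distribs)
  have "(\<Sum>i<N. ?C (w i) * (rf_z ^ m i * v i) * (inverse rf_z ^ m i * v' i)) + ?H * rf_reciprocal ?H =
      (\<Sum>j<N. ?C (w j) * v j * v' j) + 1"
    using lossless_quadratic_form[of N "\<lambda>i. ?C (w i)" "\<lambda>i j. ?C (A $$ (i, j))"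
        "\<lambda>j. ?C (c $$ (0, j))" "\<lambda>i. ?C (b $$ (i, 0))" "?C d" v v', OF AA' Ab' bb']
    by (simp add: v v' H' flip: H)
  \<comment> \<open>The delays enter only through z^{m_i} and z^{-m_i}, whose product is 1; this
    needs the weight to be diagonal.\<close>
  moreover have "?C (w i) * (rf_z ^ m i * v i) * (inverse rf_z ^ m i * v' i) = ?C (w i) * v i * v' i" for i
    by (simp add: field_simps)
  ultimately show "?H * rf_subst ?H (inverse rf_z) = 1"
    by (simp add: rf_reciprocal_def)
qed

subsection \<open>System poles\<close>

lemma orthonormal_mat_columns:
  assumes "orthonormal_mat N U" "j < N" "k < N"
  shows "(\<Sum>i<N. U $$ (i, j) * U $$ (i, k)) = (if j = k then 1 else 0)"
proof -
  have U: "U \<in> carrier_mat N N" and UU: "transpose_mat U * U = 1\<^sub>m N"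
    using assms(1) by (simp_all add: orthonormal_mat_def)
  have "(\<Sum>i<N. U $$ (i, j) * U $$ (i, k)) = (transpose_mat U * U) $$ (j, k)"
    using U assms(2,3) by (simp add: scalar_prod_def atLeast0LessThan)
  then show ?thesis
    using assms(2,3) by (simp add: UU)
qed

lemma orthonormal_mat_norm:
  fixes x :: "nat \<Rightarrow> complex"
  assumes U: "orthonormal_mat N U"
  shows "(\<Sum>i<N. (cmod (\<Sum>j<N. of_real (U $$ (i, j)) * x j))\<^sup>2) = (\<Sum>j<N. (cmod (x j))\<^sup>2)"
proof -
  have cols: "(\<Sum>i<N. complex_of_real (U $$ (i, j)) * of_real (U $$ (i, k))) = (if j = k then 1 else 0)"
    if "j < N" "k < N" for j k
    using arg_cong[OF orthonormal_mat_columns[OF U that], of complex_of_real] by simp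
  have "(\<Sum>i<N. (\<Sum>j<N. of_real (U $$ (i, j)) * x j) * (\<Sum>j<N. of_real (U $$ (i, j)) * cnj (x j))) =
      (\<Sum>j<N. x j * cnj (x j))"
    \<comment> \<open>With w = 1, b = c = 0 and d = 1 the form is the plain one, with an extra 1 on
      both sides; pairing x with its conjugate gives squared moduli.\<close>
    using lossless_quadratic_form[of N "\<lambda>_. 1" "\<lambda>i j. complex_of_real (U $$ (i, j))"
        "\<lambda>_. 0" "\<lambda>_. 0" 1 x "\<lambda>j. cnj (x j)"] cols by simp
  then have "complex_of_real (\<Sum>i<N. (cmod (\<Sum>j<N. of_real (U $$ (i, j)) * x j))\<^sup>2) =
      of_real (\<Sum>j<N. (cmod (x j))\<^sup>2)"
    by (simp add: complex_norm_square del: of_real_power flip: of_real_power)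
  then show ?thesis by (simp only: of_real_eq_iff)
qed

text \<open>At a pole, D(z) - U diag(g) has a nonzero kernel vector v, so D(z) v = U diag(g) v.
  Taking norms removes the isometry U.\<close>

lemma loop_mat_pole_energy:
  assumes U: "orthonormal_mat N U"
    and z: "z \<in> system_poles N m (U * mat_diag N g)"
  obtains v where "\<exists>i<N. v i \<noteq> 0"
    "(\<Sum>i<N. (cmod z ^ m i)\<^sup>2 * (cmod (v i))\<^sup>2) = (\<Sum>i<N. (g i)\<^sup>2 * (cmod (v i))\<^sup>2)"
proof -
  let ?A = "U * mat_diag N g"
  \<comment> \<open>Evaluation at z is a ring homomorphism, so it commutes with the
    determinant.\<close>
  define h where "h p = poly (map_poly complex_of_real p) z" for p
  interpret complex_poly: map_poly_inj_idom_hom complex_of_real ..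
  interpret h: comm_ring_hom h
    by unfold_locales (simp_all add: h_def complex_poly.hom_add complex_poly.hom_mult)
  have Uc: "U \<in> carrier_mat N N" using U by (simp add: orthonormal_mat_def)
  then have A: "?A \<in> carrier_mat N N" by (auto intro: mult_carrier_mat)
  let ?M = "map_mat h (loop_mat N m ?A)"
  have M: "?M \<in> carrier_mat N N" using A by (auto simp: loop_mat_def intro!: minus_carrier_mat)
  have "h (det (loop_mat N m ?A)) = 0"
    using z by (simp add: system_poles_def h_def)
  then have "det ?M = 0" by simp
  then obtain x where x: "x \<in> carrier_vec N" "x \<noteq> 0\<^sub>v N" "?M *\<^sub>v x = 0\<^sub>v N"
    using det_0_iff_vec_prod_zero_field[OF M] by auto
  define v where "v i = x $ i" for i
  have Mij: "?M $$ (i, j) = (if i = j then z ^ m i else 0) - of_real (U $$ (i, j)) * of_real (g j)"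
    if "i < N" "j < N" for i j
    using that A Uc by (auto simp: loop_mat_def mat_diag_def[of N "\<lambda>i. monom 1 (m i)"]
        mat_diag_mult_right[OF Uc] h_def hom_distribs poly_monom)
  have zv: "z ^ m i * v i = (\<Sum>j<N. of_real (U $$ (i, j)) * (of_real (g j) * v j))" if i: "i < N" for i
  proof -
    have "0 = (?M *\<^sub>v x) $ i" using i x by simp
    also have "\<dots> = (\<Sum>j<N. ?M $$ (i, j) * v j)"
      using i M x(1) by (simp add: scalar_prod_def atLeast0LessThan v_def del: index_map_mat)
    also have "\<dots> = (\<Sum>j<N. (if i = j then z ^ m i * v i else 0) -
        of_real (U $$ (i, j)) * (of_real (g j) * v j))"
      using i by (intro sum.cong refl) (auto simp: Mij left_diff_distrib simp del: index_map_mat)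
    also have "\<dots> = z ^ m i * v i - (\<Sum>j<N. of_real (U $$ (i, j)) * (of_real (g j) * v j))"
      using i by (simp add: sum_subtractf)
    finally show ?thesis by simp
  qed
  show thesis
  proof
    show "\<exists>i<N. v i \<noteq> 0" using x by (auto simp: v_def vec_eq_iff)
    have "(\<Sum>i<N. (cmod z ^ m i)\<^sup>2 * (cmod (v i))\<^sup>2) = (\<Sum>i<N. (cmod (z ^ m i * v i))\<^sup>2)"
      by (simp add: norm_mult norm_power power_mult_distrib)
    also have "\<dots> = (\<Sum>i<N. (cmod (of_real (g i) * v i))\<^sup>2)"
      by (simp add: zv orthonormal_mat_norm[OF U])
    also have "\<dots> = (\<Sum>i<N. (g i)\<^sup>2 * (cmod (v i))\<^sup>2)"
      by (simp add: norm_mult power_mult_distrib)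
    finally show "(\<Sum>i<N. (cmod z ^ m i)\<^sup>2 * (cmod (v i))\<^sup>2) = (\<Sum>i<N. (g i)\<^sup>2 * (cmod (v i))\<^sup>2)" .
  qed
qed

text \<open>Rules out the energy balance at a pole when all |z|^{m_i} lie strictly on the same side
  of the gains.\<close>

lemma weighted_sum_strict_mono:
  fixes f g :: "nat \<Rightarrow> real" and v :: "nat \<Rightarrow> complex"
  assumes "\<And>i. i < N \<Longrightarrow> 0 \<le> f i \<and> f i < g i" "\<exists>i<N. v i \<noteq> 0"
  shows "(\<Sum>i<N. (f i)\<^sup>2 * (cmod (v i))\<^sup>2) < (\<Sum>i<N. (g i)\<^sup>2 * (cmod (v i))\<^sup>2)"
proof (rule sum_strict_mono_ex1)
  have sq: "(f i)\<^sup>2 < (g i)\<^sup>2" if "i < N" for i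
    using assms(1)[OF that] by (simp add: power_strict_mono)
  then show "\<forall>i\<in>{..<N}. (f i)\<^sup>2 * (cmod (v i))\<^sup>2 \<le> (g i)\<^sup>2 * (cmod (v i))\<^sup>2"
    by (simp add: mult_right_mono less_imp_le)
  obtain i where "i < N" "v i \<noteq> 0" using assms(2) by blast
  then show "\<exists>i\<in>{..<N}. (f i)\<^sup>2 * (cmod (v i))\<^sup>2 < (g i)\<^sup>2 * (cmod (v i))\<^sup>2"
    using sq by (intro bexI[of _ i] mult_strict_right_mono) auto
qed simp

lemma system_pole_bounds:
  assumes U: "orthonormal_mat N U" and g: "\<And>i. i < N \<Longrightarrow> 0 \<le> g i"
    and z: "z \<in> system_poles N m (U * mat_diag N g)"
  shows "\<exists>i<N. cmod z ^ m i \<le> g i" and "\<exists>i<N. g i \<le> cmod z ^ m i"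
proof -
  obtain v where nz: "\<exists>i<N. v i \<noteq> 0" and
    eq: "(\<Sum>i<N. (cmod z ^ m i)\<^sup>2 * (cmod (v i))\<^sup>2) = (\<Sum>i<N. (g i)\<^sup>2 * (cmod (v i))\<^sup>2)"
    using loop_mat_pole_energy[OF U z] by blast
  show "\<exists>i<N. cmod z ^ m i \<le> g i"
    using weighted_sum_strict_mono[of N g "\<lambda>i. cmod z ^ m i", OF _ nz] g eq by force
  show "\<exists>i<N. g i \<le> cmod z ^ m i"
    using weighted_sum_strict_mono[of N "\<lambda>i. cmod z ^ m i" g, OF _ nz] eq by force
qed

text \<open>If the determinant vanished identically, z = 1 would be a pole. There |z|^{m_i} = 1 for
  any delays, exceeding every gain.\<close>

lemma det_loop_mat_nonzero:
  assumes "orthonormal_mat N U" and "\<And>i. i < N \<Longrightarrow> 0 \<le> g i \<and> g i < 1"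
  shows "det (loop_mat N m (U * mat_diag N g)) \<noteq> 0"
proof
  assume "det (loop_mat N m (U * mat_diag N g)) = 0"
  then have "1 \<in> system_poles N m (U * mat_diag N g)" by (simp add: system_poles_def)
  from system_pole_bounds(1)[OF assms(1) _ this] assms(2) show False by force
qed

text \<open>For gains \<gamma>^{m_i} the two pole bounds, possibly at different indices, become |z|
  \<le> \<gamma> and \<gamma> \<le> |z| after taking roots.\<close>

lemma homogeneous_decay_orthonormal:
  assumes "orthonormal_mat N U" and m: "\<forall>i<N. 0 < m i" and "0 < \<gamma>"
  shows "homogeneous_decay N m (U * mat_diag N (gain \<gamma> m)) \<gamma>"
  unfolding homogeneous_decay_def
proof
  fix z assume z: "z \<in> system_poles N m (U * mat_diag N (gain \<gamma> m))"
  note bounds = system_pole_bounds[OF assms(1) _ z]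
  obtain i k where "i < N" "cmod z ^ m i \<le> \<gamma> ^ m i" "k < N" "\<gamma> ^ m k \<le> cmod z ^ m k"
    using bounds assms(3) by (auto simp: gain_def)
  then show "cmod z = \<gamma>"
    using m assms(3) by (intro antisym) (auto simp: power_mono_iff)
qed

subsection \<open>The Cauchy-like matrix\<close>

text \<open>The chain 0 < q_0 < p_0 < q_1 < p_1 < ... determines the sign of every difference
  occurring in \<open>alpha\<close> and \<open>beta\<close>.\<close>

locale interlacing_nodes =
  fixes N :: nat and p q :: "nat \<Rightarrow> real"
  assumes q_pos: "i < N \<Longrightarrow> 0 < q i"
    and q_less_p: "i < N \<Longrightarrow> q i < p i"
    and p_less_q: "i < k \<Longrightarrow> k < N \<Longrightarrow> p i < q k"
begin

lemma p_pos: "i < N \<Longrightarrow> 0 < p i"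
  using q_pos q_less_p by (meson less_trans)

lemma p_less_p: "i < k \<Longrightarrow> k < N \<Longrightarrow> p i < p k"
  using p_less_q q_less_p by (meson less_trans)

lemma q_less_q: "i < k \<Longrightarrow> k < N \<Longrightarrow> q i < q k"
  using p_less_q q_less_p by (meson less_trans)

lemma p_neq_q: "i < N \<Longrightarrow> j < N \<Longrightarrow> p i \<noteq> q j"
  using p_less_q[of i j] q_less_p[of i] q_less_q[of j i] by (cases i j rule: linorder_cases) auto

lemma inj_p: "inj_on p {..<N}"
  by (rule linorder_inj_onI') (use p_less_p in force)

lemma inj_q: "inj_on q {..<N}"
  by (rule linorder_inj_onI') (use q_less_q in force)

text \<open>For k other than i, interlacing puts p_k and q_k on the same side of q_i, so each
  quotient is positive; the minus sign in \<open>alpha\<close> turns the remaining factor into p_i -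
  q_i. The argument for \<open>beta\<close> is the same around p_i.\<close>

lemma alpha_pos:
  assumes i: "i < N"
  shows "0 < alpha N p q i"
proof -
  have "poly (node_poly N p) (q i) = - ((p i - q i) * (\<Prod>k\<in>{..<N} - {i}. q i - p k))"
    using i by (simp add: poly_node_poly prod.remove[of _ i] flip: mult_minus_left)
  then have "alpha N p q i = (p i - q i) * (\<Prod>k\<in>{..<N} - {i}. (q i - p k) / (q i - q k))"
    using i by (simp add: alpha_def poly_pderiv_node_poly_node prod_dividef)
  moreover have "0 < (q i - p k) / (q i - q k)" if "k < N" "k \<noteq> i" for k
    using that i p_less_q[of k i] q_less_q[of k i] q_less_q[of i k] q_less_p[of k]
    by (cases k i rule: linorder_cases) (auto simp: zero_less_divide_iff)
  ultimately show ?thesis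
    using i q_less_p by (auto intro!: mult_pos_pos prod_pos)
qed

lemma beta_pos:
  assumes i: "i < N"
  shows "0 < beta N p q i"
proof -
  have "poly (node_poly N q) (p i) = (p i - q i) * (\<Prod>k\<in>{..<N} - {i}. p i - q k)"
    using i by (simp add: poly_node_poly prod.remove[of _ i])
  then have "beta N p q i = (p i - q i) * (\<Prod>k\<in>{..<N} - {i}. (p i - q k) / (p i - p k))"
    using i by (simp add: beta_def poly_pderiv_node_poly_node prod_dividef)
  moreover have "0 < (p i - q k) / (p i - p k)" if "k < N" "k \<noteq> i" for k
    using that i p_less_q[of i k] p_less_p[of k i] p_less_p[of i k] q_less_p[of k]
    by (cases k i rule: linorder_cases) (auto simp: zero_less_divide_iff)
  ultimately show ?thesis
    using i q_less_p by (auto intro!: mult_pos_pos prod_pos)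
qed

section \<open>Sum identities at the interlacing nodes\<close>

lemma sum_alpha: "i < N \<Longrightarrow> (\<Sum>j<N. alpha N p q j / (p i - q j)) = 1"
  by (rule sum_alpha_over_node_diff) (auto simp: inj_q p_neq_q)

lemma sum_beta:
  assumes "j < N"
  shows "(\<Sum>i<N. beta N p q i / (p i - q j)) = 1"
proof -
  have "(\<Sum>i<N. alpha N q p i / (q j - p i)) = 1"
    using assms by (intro sum_alpha_over_node_diff) (auto simp: inj_p p_neq_q[symmetric])
  moreover have "alpha N q p i / (q j - p i) = beta N p q i / (p i - q j)" for i
    unfolding beta_conv_alpha by (metis minus_diff_eq minus_divide_divide)
  ultimately show ?thesis by simp
qed

text \<open>The partial fraction expansion of B/A at t = 0; the product is \<delta>^2 =
  B(0)/A(0).\<close>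

lemma sum_beta_over_p: "(\<Sum>i<N. beta N p q i / p i) = 1 - (\<Prod>i<N. q i / p i)"
proof -
  have "(\<Sum>i<N. alpha N q p i / (0 - p i)) = 1 - poly (node_poly N q) 0 / poly (node_poly N p) 0"
    using p_pos by (intro sum_alpha_over_diff) (force simp: inj_p)+
  also have "poly (node_poly N q) 0 / poly (node_poly N p) 0 = (\<Prod>i<N. q i / p i)"
    by (simp add: poly_node_poly flip: prod_dividef)
  finally show ?thesis by (simp add: beta_conv_alpha)
qed

text \<open>The squared norm of row i of U: the sum equals A'(p_i)/B(p_i), the reciprocal of
  \<open>beta\<close>.\<close>

lemma beta_times_sum_alpha_square:
  assumes "i < N"
  shows "beta N p q i * (\<Sum>j<N. alpha N p q j / (p i - q j)\<^sup>2) = 1"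
proof -
  have "(\<Sum>j<N. alpha N p q j / (p i - q j)\<^sup>2) =
      poly (pderiv (node_poly N p)) (p i) / poly (node_poly N q) (p i)"
    using assms by (intro sum_alpha_over_node_diff_square) (auto simp: inj_q p_neq_q)
  then show ?thesis using beta_pos[OF assms] by (auto simp: beta_def zero_less_divide_iff)
qed

text \<open>Orthogonality of distinct rows of U. The summand splits into a difference of two simple
  fractions over p_k - p_i, and both resulting sums equal 1.\<close>

lemma sum_alpha_off_diagonal:
  assumes "i < N" "k < N" "i \<noteq> k"
  shows "(\<Sum>j<N. alpha N p q j / ((p i - q j) * (p k - q j))) = 0"
proof -
  have ne: "p k - p i \<noteq> 0" using assms inj_p by (auto simp: inj_on_def)
  have "alpha N p q j / ((p i - q j) * (p k - q j)) =
      (alpha N p q j / (p i - q j) - alpha N p q j / (p k - q j)) / (p k - p i)" if "j < N" for j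
    using ne p_neq_q[OF assms(1) that] p_neq_q[OF assms(2) that]
    by (simp add: divide_simps) (simp add: algebra_simps)
  then show ?thesis
    using assms by (simp add: sum_subtractf sum_alpha flip: sum_divide_distrib)
qed

lemma cauchy_like_entry:
  assumes "i < N" "j < N"
  shows "cauchy_like_mat N p q $$ (i, j) =
    sqrt (beta N p q i) * sqrt (alpha N p q j) / (p i - q j)"
  using assms by (simp add: cauchy_like_mat_def real_sqrt_mult)

text \<open>The sums over \<open>alpha\<close> give orthonormal rows; orthonormal columns follow
  since a right inverse of a square matrix is a left inverse.\<close>

lemma orthonormal_cauchy_like_mat: "orthonormal_mat N (cauchy_like_mat N p q)"
proof -
  let ?U = "cauchy_like_mat N p q"
  have U: "?U \<in> carrier_mat N N" by (simp add: cauchy_like_mat_def)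
  have "?U * transpose_mat ?U = 1\<^sub>m N"
  proof (rule eq_matI)
    fix i k assume "i < dim_row (1\<^sub>m N)" "k < dim_col (1\<^sub>m N)"
    then have i: "i < N" and k: "k < N" by simp_all
    have "(?U * transpose_mat ?U) $$ (i, k) = (\<Sum>j<N. ?U $$ (i, j) * ?U $$ (k, j))"
      using U i k by (simp add: scalar_prod_def atLeast0LessThan)
    also have "\<dots> = (\<Sum>j<N. sqrt (beta N p q i) * sqrt (beta N p q k) *
        (alpha N p q j / ((p i - q j) * (p k - q j))))"
    proof (rule sum.cong[OF refl])
      fix j assume "j \<in> {..<N}"
      then have j: "j < N" by simp
      have "x * a / u * (y * a / v) = x * y * (a * a / (u * v))" for x y a u v :: real
        by simp
      moreover have "alpha N p q j = sqrt (alpha N p q j) * sqrt (alpha N p q j)"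
        using alpha_pos[OF j] by simp
      ultimately show "?U $$ (i, j) * ?U $$ (k, j) = sqrt (beta N p q i) * sqrt (beta N p q k) *
          (alpha N p q j / ((p i - q j) * (p k - q j)))"
        by (metis cauchy_like_entry i j k)
    qed
    also have "\<dots> = sqrt (beta N p q i) * sqrt (beta N p q k) *
        (\<Sum>j<N. alpha N p q j / ((p i - q j) * (p k - q j)))"
      by (simp add: sum_distrib_left)
    also have "\<dots> = (if i = k then 1 else 0)"
      using sum_alpha_off_diagonal[OF i k] beta_times_sum_alpha_square[OF i] beta_pos[OF i]
      by (auto simp: power2_eq_square)
    finally show "(?U * transpose_mat ?U) $$ (i, k) = 1\<^sub>m N $$ (i, k)"
      using i k by simp
  qed (use U in auto)
  then show ?thesis
    unfolding orthonormal_mat_def using U mat_mult_left_right_inverse[OF U, of "transpose_mat ?U"]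
    by auto
qed

lemma uniallpass_cauchy_like_mat:
  assumes g: "\<And>i. i < N \<Longrightarrow> 0 < g i \<and> g i < 1" and q: "\<And>i. i < N \<Longrightarrow> q i = (g i)\<^sup>2 * p i"
  shows "\<exists>b \<in> carrier_mat N 1. \<exists>c \<in> carrier_mat 1 N. \<exists>d.
    uniallpass N (cauchy_like_mat N p q * mat_diag N g) b c d"
proof -
  let ?U = "cauchy_like_mat N p q"
  let ?A = "?U * mat_diag N g"
  define \<alpha> where "\<alpha> j = sqrt (alpha N p q j)" for j
  define \<beta> where "\<beta> i = sqrt (beta N p q i)" for i
  \<comment> \<open>Losslessness forces d^2 = 1 - sum of beta_i / p_i, which is this product; c
    below is then what makes the mixed condition with b vanish.\<close>
  define d where "d = sqrt (\<Prod>i<N. q i / p i)"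
  define b where "b = mat N 1 (\<lambda>(i, j). \<beta> i)"
  define c where "c = mat 1 N (\<lambda>(i, j). - (d * \<alpha> j * g j / q j))"
  have bb: "\<beta> i * \<beta> i = beta N p q i" if "i < N" for i
    using beta_pos[OF that] by (simp add: \<beta>_def)
  have "0 \<le> (\<Prod>i<N. q i / p i)"
    using q_pos p_pos by (intro prod_nonneg) (auto intro: less_imp_le)
  then have dd: "d * d = (\<Prod>i<N. q i / p i)" by (simp add: d_def)
  have U: "?U \<in> carrier_mat N N" by (simp add: cauchy_like_mat_def)
  have Uij: "?U $$ (i, j) = \<beta> i * \<alpha> j / (p i - q j)" if "i < N" "j < N" for i j
    using that by (simp add: cauchy_like_entry \<alpha>_def \<beta>_def)
  have Aij: "?A $$ (i, j) = ?U $$ (i, j) * g j" if "i < N" "j < N" for i j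
    using that by (simp add: mat_diag_mult_right[OF U])
  \<comment> \<open>Uses 1/(p(p - q)) = (1/(p - q) - 1/p)/q; the two sums are 1 and 1 - d^2.\<close>
  have sb: "(\<Sum>i<N. beta N p q i / (p i * (p i - q k))) = d * d / q k" if k: "k < N" for k
  proof -
    have "beta N p q i / (p i * (p i - q k)) =
        (beta N p q i / (p i - q k) - beta N p q i / p i) / q k" if "i < N" for i
      using q_pos[OF k] p_pos[OF that] p_neq_q[OF that k]
      by (simp add: divide_simps) (simp add: algebra_simps)
    then show ?thesis
      using k by (simp add: sum_subtractf sum_beta sum_beta_over_p dd flip: sum_divide_distrib)
  qed
  \<comment> \<open>The entries of U^T P^{-1} U. Writing 1/p_i = (1 - (p_i - q_j)/p_i)/q_j reduces
    them to column orthonormality and \<open>sb\<close>.\<close>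
  have UU: "(\<Sum>i<N. 1 / p i * ?U $$ (i, j) * ?U $$ (i, k)) =
      ((if j = k then 1 else 0) - \<alpha> j * \<alpha> k * (d * d / q k)) / q j" if "j < N" "k < N" for j k
  proof -
    have "1 / p i * ?U $$ (i, j) * ?U $$ (i, k) =
        (?U $$ (i, j) * ?U $$ (i, k) - \<alpha> j * \<alpha> k * (beta N p q i / (p i * (p i - q k)))) / q j"
      if i: "i < N" for i
      using q_pos[OF \<open>j < N\<close>] p_pos[OF i] p_neq_q[OF i \<open>k < N\<close>] p_neq_q[OF i \<open>j < N\<close>]
      unfolding Uij[OF i \<open>j < N\<close>] Uij[OF i \<open>k < N\<close>] bb[OF i, symmetric]
      by (simp add: divide_simps) (simp add: algebra_simps)
    then have "(\<Sum>i<N. 1 / p i * ?U $$ (i, j) * ?U $$ (i, k)) = (\<Sum>i<N. (?U $$ (i, j) *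
        ?U $$ (i, k) - \<alpha> j * \<alpha> k * (beta N p q i / (p i * (p i - q k)))) / q j)"
      by (intro sum.cong) auto
    then show ?thesis
      by (simp only: sum_subtractf sb that orthonormal_mat_columns[OF orthonormal_cauchy_like_mat]
          flip: sum_divide_distrib sum_distrib_left)
  qed
  have "uniallpass N ?A b c d"
  proof (rule uniallpass_if_lossless[where w = "\<lambda>i. 1 / p i"])
    show "?A \<in> carrier_mat N N" "b \<in> carrier_mat N 1" "c \<in> carrier_mat 1 N"
      using U by (auto simp: b_def c_def intro: mult_carrier_mat)
    show "det (loop_mat N m ?A) \<noteq> 0" for m
      using g by (intro det_loop_mat_nonzero orthonormal_cauchy_like_mat) (auto intro: less_imp_le)
    show "(\<Sum>i<N. 1 / p i * ?A $$ (i, j) * ?A $$ (i, k)) + c $$ (0, j) * c $$ (0, k) =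
        (if j = k then 1 / p j else 0)" if j: "j < N" and k: "k < N" for j k
    proof -
      have "(\<Sum>i<N. 1 / p i * ?A $$ (i, j) * ?A $$ (i, k)) =
          g j * g k * (\<Sum>i<N. 1 / p i * ?U $$ (i, j) * ?U $$ (i, k))"
        using j k by (simp add: Aij sum_distrib_left mult_ac)
      also have "\<dots> = g j * g k * (((if j = k then 1 else 0) - \<alpha> j * \<alpha> k * (d * d / q k)) / q j)"
        by (simp only: UU[OF j k])
      also have "\<dots> + c $$ (0, j) * c $$ (0, k) = (if j = k then (g j)\<^sup>2 / q j else 0)"
        using j k q_pos[OF j] q_pos[OF k]
        by (auto simp: c_def power2_eq_square divide_simps) (simp_all add: algebra_simps)
      \<comment> \<open>Here the relation q_j = g_j^2 p_j returns the weight to its original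
        value.\<close>
      also have "(g j)\<^sup>2 / q j = 1 / p j"
        using g[OF j] by (simp add: q[OF j])
      finally show ?thesis .
    qed
    show "(\<Sum>i<N. 1 / p i * ?A $$ (i, j) * b $$ (i, 0)) + c $$ (0, j) * d = 0" if j: "j < N" for j
    proof -
      have "(\<Sum>i<N. 1 / p i * ?A $$ (i, j) * b $$ (i, 0)) =
          (\<Sum>i<N. \<alpha> j * g j * (beta N p q i / (p i * (p i - q j))))"
        using j by (intro sum.cong refl) (simp add: Aij Uij b_def mult_ac flip: bb)
      also have "\<dots> = \<alpha> j * g j * (d * d / q j)"
        by (simp only: sb[OF j] flip: sum_distrib_left)
      finally show ?thesis using j by (simp add: c_def)
    qed
    show "(\<Sum>i<N. 1 / p i * b $$ (i, 0) * b $$ (i, 0)) + d * d = 1"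
      using sum_beta_over_p by (simp add: b_def dd bb)
  qed
  then show ?thesis
    by (intro bexI[of _ b] bexI[of _ c] exI[of _ d]) (auto simp: b_def c_def)
qed

end

section \<open>Admissible nodes: interlacing and existence\<close>

lemma interlacing_nodes_if_admissible:
  assumes g: "\<And>i. i < N \<Longrightarrow> 0 < g i \<and> g i < 1" and p: "admissible_nodes N g p"
  shows "interlacing_nodes N p (\<lambda>i. (g i)\<^sup>2 * p i)"
proof
  have p_pos: "0 < p i" if "i < N" for i
    using p that by (simp add: admissible_nodes_def)
  show "0 < (g i)\<^sup>2 * p i" if "i < N" for i
    using g[OF that] p_pos[OF that] by simp
  show less: "(g i)\<^sup>2 * p i < p i" if "i < N" for i
    using g[OF that] p_pos[OF that] by (simp add: power_less_one_iff)
  have step: "p i < (g (Suc i))\<^sup>2 * p (Suc i)" if "Suc i < N" for i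
  proof -
    have "p i / p (Suc i) < (g (Suc i))\<^sup>2"
      using p that by (auto simp: admissible_nodes_def dest!: conjunct2 spec[of _ "Suc i"])
    then show ?thesis using p_pos[OF that] by (simp add: pos_divide_less_eq)
  qed
  \<comment> \<open>Admissibility compares neighbours only; induction on k extends it along the
    chain, using q_k < p_k at each link.\<close>
  show "p i < (g k)\<^sup>2 * p k" if "i < k" "k < N" for i k
    using that
  proof (induction k)
    case (Suc k)
    then show ?case
      using step[of k] less[of k] by (cases "i = k") auto
  qed simp
qed

lemma admissible_nodes_exist:
  assumes "\<And>i. i < N \<Longrightarrow> 0 < g i"
  shows "\<exists>p. admissible_nodes N g p"
proof
  \<comment> \<open>Consecutive ratios p_{i-1}/p_i are then g_i^2 / 2, half of the allowed
    bound.\<close>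
  let ?p = "\<lambda>i. \<Prod>k\<le>i. 2 / (g k)\<^sup>2"
  have pos: "0 < ?p i" if "i < N" for i
  proof (intro prod_pos)
    fix k assume "k \<in> {..i}"
    then have "0 < g k" using assms that by simp
    then show "0 < 2 / (g k)\<^sup>2" by simp
  qed
  have ratio: "?p (i - 1) / ?p i = (g i)\<^sup>2 / 2" if "1 \<le> i" "i < N" for i
  proof -
    have "?p i = ?p (i - 1) * (2 / (g i)\<^sup>2)"
      using prod.atMost_Suc[of "\<lambda>k. 2 / (g k)\<^sup>2" "i - 1"] that by simp
    moreover have "0 < ?p (i - 1)" using that by (intro pos) simp
    moreover have "x / (x * (2 / (g i)\<^sup>2)) = (g i)\<^sup>2 / 2" if "0 < x" for x
      using that by simp
    ultimately show ?thesis by metis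
  qed
  have "0 < ?p (i - 1) / ?p i \<and> ?p (i - 1) / ?p i < (g i)\<^sup>2" if "1 \<le> i" "i < N" for i
    unfolding ratio[OF that] using assms[OF that(2)] by simp
  then show "admissible_nodes N g ?p"
    unfolding admissible_nodes_def using pos by blast
qed

theorem mainTheorem4:
  fixes N :: nat and m :: "nat \<Rightarrow> nat" and \<gamma> :: real
  assumes "1 \<le> N"
    and "\<forall>i<N. 0 < m i"
    and "0 < \<gamma>" and "\<gamma> < 1"
  shows "(\<exists>p. admissible_nodes N (gain \<gamma> m) p) \<and>
    (\<forall>p q U. admissible_nodes N (gain \<gamma> m) p \<longrightarrow>
        q = (\<lambda>i. (gain \<gamma> m i)\<^sup>2 * p i) \<longrightarrow>
        U = cauchy_like_mat N p q \<longrightarrow>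
        (\<forall>i<N. 0 < alpha N p q i \<and> 0 < beta N p q i) \<and>
        orthonormal_mat N U \<and>
        (\<exists>b \<in> carrier_mat N 1. \<exists>c \<in> carrier_mat 1 N. \<exists>d.
           uniallpass N (U * mat_diag N (gain \<gamma> m)) b c d)) \<and>
    (\<exists>A \<in> carrier_mat N N. \<exists>b \<in> carrier_mat N 1. \<exists>c \<in> carrier_mat 1 N. \<exists>d.
        uniallpass N A b c d \<and> homogeneous_decay N m A \<gamma>)"
proof -
  let ?g = "gain \<gamma> m"
  have g: "0 < ?g i \<and> ?g i < 1" if "i < N" for i
    using assms that by (simp add: gain_def power_less_one_iff)
  have main: "(\<forall>i<N. 0 < alpha N p q i \<and> 0 < beta N p q i) \<and> orthonormal_mat N (cauchy_like_mat N p q) \<and>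
      (\<exists>b \<in> carrier_mat N 1. \<exists>c \<in> carrier_mat 1 N. \<exists>d.
        uniallpass N (cauchy_like_mat N p q * mat_diag N ?g) b c d)"
    if p: "admissible_nodes N ?g p" and q: "q = (\<lambda>i. (?g i)\<^sup>2 * p i)" for p q
  proof -
    interpret interlacing_nodes N p q
      unfolding q using g p by (rule interlacing_nodes_if_admissible)
    show ?thesis
      using alpha_pos beta_pos orthonormal_cauchy_like_mat uniallpass_cauchy_like_mat[of ?g] g
      by (simp add: q)
  qed
  obtain p where p: "admissible_nodes N ?g p"
    using admissible_nodes_exist[of N ?g] g by blast
  \<comment> \<open>One admissible choice of nodes settles the final claim: decay follows from
    orthogonality of U, and b, c, d come from \<open>main\<close>.\<close>
  define U where "U = cauchy_like_mat N p (\<lambda>i. (?g i)\<^sup>2 * p i)"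
  from main[OF p refl] have U: "orthonormal_mat N U" and
    bcd: "\<exists>b \<in> carrier_mat N 1. \<exists>c \<in> carrier_mat 1 N. \<exists>d. uniallpass N (U * mat_diag N ?g) b c d"
    by (auto simp: U_def)
  have "U * mat_diag N ?g \<in> carrier_mat N N"
    using U by (auto simp: orthonormal_mat_def intro: mult_carrier_mat)
  moreover have "homogeneous_decay N m (U * mat_diag N ?g) \<gamma>"
    using U assms by (intro homogeneous_decay_orthonormal) auto
  ultimately have "\<exists>A \<in> carrier_mat N N. \<exists>b \<in> carrier_mat N 1. \<exists>c \<in> carrier_mat 1 N. \<exists>d.
      uniallpass N A b c d \<and> homogeneous_decay N m A \<gamma>"
    using bcd by blast
  with p main show ?thesis by blast
qed

end
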